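(* Let $K$ be a field of characteristic $\neq 2$, and let $Q=(x,y,z)\in K[t]^3$ be a standard Pythagorean triple with $x\neq 0$. Then there exist $c\in K^*$, $f\in K[t]\setminus K$, and a (possibly empty) finite sequence $f_1,\dots,f_k$ of elements of $K[t]\setminus K$ such that $$Q^T = c\,M_{f_1}\cdots M_{f_k}\,S_f^T .$$ Moreover, this representation of $Q$ is unique, i.e. $c$, $f$, the length $k\ge 0$, and the sequence $(f_1,\dots,f_k)$ are uniquely determined by $Q$.
   Context: $K[t]$ is the polynomial ring in one variable over $K$. Write $\deg f$ for the degree of a polynomial, with $\deg 0=-\infty$, and $\ell(f)$ for the leading coefficient of a nonzero polynomial $f$. A Pythagorean triple is a nonzero triple $(x,y,z)\in K[t]^3$ with $x^2+y^2=z^2$; it is primitive if $\gcd(x,y,z)=1$. A standard Pythagorean triple is a primitive Pythagorean triple $(x,y,z)$ with $\deg x<\deg y=\deg z$ and $\ell(y)=\ell(z)$. For $f\in K[t]$, put $S_f=(2f,\;f^2-1,\;f^2+1)$ and $$M_f=\begin{pmatrix}-1 & 2f & 2f\\ -2f & 2f^2-1 & 2f^2\\ -2f & 2f^2 & 2f^2+1\end{pmatrix}.$$ $Q^T$ denotes the column vector which is the transpose of the row $Q$. *)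

theory Defs
  imports "HOL-Analysis.Cartesian_Space" "HOL-Computational_Algebra.Polynomial"
    "HOL-Library.Extended_Real"
begin

text \<open>The library has \<open>degree 0 = 0\<close>; here the zero polynomial has degree minus infinity.\<close>

definition pdeg :: "'a::zero poly \<Rightarrow> ereal" where
  "pdeg f = (if f = 0 then -\<infinity> else ereal (real (degree f)))"

definition pythagorean_triple :: "('a::field poly)^3 \<Rightarrow> bool" where
  "pythagorean_triple Q \<longleftrightarrow> Q \<noteq> 0 \<and> (Q$1)\<^sup>2 + (Q$2)\<^sup>2 = (Q$3)\<^sup>2"

text \<open>The condition \<open>gcd(x,y,z) = 1\<close> is expressed by divisibility, as the library's \<open>gcd\<close> on
  polynomials is not available over an arbitrary type of class \<open>field\<close>.\<close>

definition primitive_triple :: "('a::field poly)^3 \<Rightarrow> bool" where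
  "primitive_triple Q \<longleftrightarrow> pythagorean_triple Q \<and>
     (\<forall>d. d dvd Q$1 \<and> d dvd Q$2 \<and> d dvd Q$3 \<longrightarrow> is_unit d)"

definition standard_triple :: "('a::field poly)^3 \<Rightarrow> bool" where
  "standard_triple Q \<longleftrightarrow> primitive_triple Q \<and>
     pdeg (Q$1) < pdeg (Q$2) \<and> pdeg (Q$2) = pdeg (Q$3) \<and>
     lead_coeff (Q$2) = lead_coeff (Q$3)"

definition S_vec :: "'a::field poly \<Rightarrow> ('a poly)^3" where
  "S_vec f = vector [2 * f, f\<^sup>2 - 1, f\<^sup>2 + 1]"

definition M_mat :: "'a::field poly \<Rightarrow> ('a poly)^3^3" where
  "M_mat f = vector
     [vector [-1,     2 * f,         2 * f        ],
      vector [-2 * f, 2 * f\<^sup>2 - 1, 2 * f\<^sup>2    ],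
      vector [-2 * f, 2 * f\<^sup>2,     2 * f\<^sup>2 + 1]]"

definition M_prod :: "'a::field poly list \<Rightarrow> ('a poly)^3^3" where
  "M_prod fs = foldr (\<lambda>g A. M_mat g ** A) fs (mat 1)"

text \<open>The set of polynomials over K that do not lie in K.\<close>

definition nonconstant_polys :: "'a::field poly set" where
  "nonconstant_polys = UNIV - range (\<lambda>a. [:a:])"

end

theory Submission
  imports Defs
begin

text \<open>The matrix \<open>M_f\<close> maps a Pythagorean triple with \<open>a = z + y\<close>, \<open>b = z - y\<close> to one with
  \<open>x' = 2fa - x\<close> and \<open>b' = a\<close>, so undoing it is division with remainder of \<open>x'\<close> by \<open>b'\<close>.
  Since \<open>ab = x\<^sup>2\<close>, this descent keeps \<open>deg x < deg a\<close> and lowers \<open>deg a\<close>, and it stops at a scalar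
  multiple of \<open>(0, 1, 1)\<close>. As \<open>S_f = M_{f/2} (0, 1, 1)\<^sup>T\<close>, this is the required representation, and
  uniqueness of division with remainder makes it unique.\<close>

text \<open>The descent invariant. It has to admit the end points c(0, 1, 1), where y + z is a
  nonzero constant; with \<open>degree 0 = 0\<close> the strict bound fails there, hence the
  separate case \<open>P$1 = 0\<close>.\<close>

definition reduced_triple :: "('a::field poly)^3 \<Rightarrow> bool" where
  "reduced_triple P \<longleftrightarrow> (P$1)\<^sup>2 + (P$2)\<^sup>2 = (P$3)\<^sup>2 \<and> P$2 + P$3 \<noteq> 0 \<and>
     (P$1 = 0 \<or> degree (P$1) < degree (P$2 + P$3))"

definition base_triple :: "'a::field \<Rightarrow> ('a poly)^3" where
  "base_triple c = vector [0, [:c:], [:c:]]"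

text \<open>This is J M_f^T J applied to P, with J = diag(1, 1, -1): the inverse of an isometry of
  x^2 + y^2 - z^2. Grouping by z - y exhibits the first entry as a division step.\<close>

definition M_inv :: "'a::field poly \<Rightarrow> ('a poly)^3 \<Rightarrow> ('a poly)^3" where
  "M_inv f P = vector
     [-P$1 + 2 * f * (P$3 - P$2),
      -P$2 + 2 * f * P$1 - 2 * f\<^sup>2 * (P$3 - P$2),
      P$3 - 2 * f * P$1 + 2 * f\<^sup>2 * (P$3 - P$2)]"

lemma base_triple_nth [simp]:
  "base_triple c $ 1 = 0" "base_triple c $ 2 = [:c:]" "base_triple c $ 3 = [:c:]"
  by (simp_all add: base_triple_def)

lemma M_inv_nth:
  "M_inv f P $ 1 = -P$1 + 2 * f * (P$3 - P$2)"
  "M_inv f P $ 2 = -P$2 + 2 * f * P$1 - 2 * f\<^sup>2 * (P$3 - P$2)"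
  "M_inv f P $ 3 = P$3 - 2 * f * P$1 + 2 * f\<^sup>2 * (P$3 - P$2)"
  by (simp_all add: M_inv_def)

lemma M_mat_vec_nth:
  "(M_mat f *v P) $ 1 = -P$1 + 2 * f * P$2 + 2 * f * P$3"
  "(M_mat f *v P) $ 2 = -2 * f * P$1 + (2 * f\<^sup>2 - 1) * P$2 + 2 * f\<^sup>2 * P$3"
  "(M_mat f *v P) $ 3 = -2 * f * P$1 + 2 * f\<^sup>2 * P$2 + (2 * f\<^sup>2 + 1) * P$3"
  by (simp_all add: M_mat_def matrix_vector_mult_def sum_3)

lemma M_inv_M_mat: "M_inv f (M_mat f *v P) = P"
  by (simp add: vec_eq_iff forall_3 M_inv_nth M_mat_vec_nth)
     (simp add: algebra_simps power2_eq_square)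

lemma M_mat_M_inv: "M_mat f *v M_inv f P = P"
  by (simp add: vec_eq_iff forall_3 M_inv_nth M_mat_vec_nth)
     (simp add: algebra_simps power2_eq_square)

section \<open>The Pythagorean equation and primitivity under M_f\<close>

lemma pythagorean_factor:
  fixes x y z :: "'a::comm_ring_1"
  shows "x\<^sup>2 + y\<^sup>2 = z\<^sup>2 \<longleftrightarrow> x\<^sup>2 = (y + z) * (z - y)"
proof -
  have eq: "(y + z) * (z - y) = z\<^sup>2 - y\<^sup>2"
    by (simp add: algebra_simps power2_eq_square)
  show ?thesis unfolding eq by (simp only: eq_diff_eq)
qed

lemma M_mat_pythagorean:
  fixes P :: "('a::field poly)^3"
  assumes "(P$1)\<^sup>2 + (P$2)\<^sup>2 = (P$3)\<^sup>2"
  shows "((M_mat f *v P)$1)\<^sup>2 + ((M_mat f *v P)$2)\<^sup>2 = ((M_mat f *v P)$3)\<^sup>2"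
proof -
  \<comment> \<open>M_f is an isometry of x^2 + y^2 - z^2, so this identity holds for every P,
    Pythagorean or not.\<close>
  have "((M_mat f *v P)$1)\<^sup>2 + ((M_mat f *v P)$2)\<^sup>2 - ((M_mat f *v P)$3)\<^sup>2
      = (P$1)\<^sup>2 + (P$2)\<^sup>2 - (P$3)\<^sup>2"
    by (simp add: M_mat_vec_nth) algebra
  with assms show ?thesis by simp
qed

lemma M_inv_pythagorean:
  fixes P :: "('a::field poly)^3"
  assumes "(P$1)\<^sup>2 + (P$2)\<^sup>2 = (P$3)\<^sup>2"
  shows "(M_inv f P $1)\<^sup>2 + (M_inv f P $2)\<^sup>2 = (M_inv f P $3)\<^sup>2"
proof -
  have "(M_inv f P $1)\<^sup>2 + (M_inv f P $2)\<^sup>2 - (M_inv f P $3)\<^sup>2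
      = (P$1)\<^sup>2 + (P$2)\<^sup>2 - (P$3)\<^sup>2"
    by (simp add: M_inv_nth) algebra
  with assms show ?thesis by simp
qed

text \<open>P is recovered from \<open>M_inv f P\<close> by a matrix with polynomial entries, so a
  common divisor of the new entries divides the old ones.\<close>

lemma primitive_triple_M_inv:
  assumes "primitive_triple P"
  shows "primitive_triple (M_inv f P)"
proof -
  have "M_inv f P \<noteq> 0"
  proof
    assume "M_inv f P = 0"
    then have "P = 0" using M_mat_M_inv[of f P] by simp
    with assms show False by (simp add: primitive_triple_def pythagorean_triple_def)
  qed
  moreover have "is_unit d"
    if d: "d dvd M_inv f P $ 1" "d dvd M_inv f P $ 2" "d dvd M_inv f P $ 3" for d
  proof -
    have "d dvd (M_mat f *v M_inv f P) $ 1" "d dvd (M_mat f *v M_inv f P) $ 2"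
      "d dvd (M_mat f *v M_inv f P) $ 3"
      unfolding M_mat_vec_nth using d by (auto intro!: dvd_add dvd_mult)
    with assms show ?thesis by (simp add: M_mat_M_inv primitive_triple_def)
  qed
  ultimately show ?thesis
    using assms M_inv_pythagorean by (auto simp: primitive_triple_def pythagorean_triple_def)
qed

section \<open>Constants, characteristic and degrees\<close>

lemma nonconstant_polys_iff: "f \<in> nonconstant_polys \<longleftrightarrow> degree f > 0"
proof -
  have "degree f = 0 \<longleftrightarrow> f \<in> range (\<lambda>a. [:a:])"
    by (auto elim!: degree_eq_zeroE)
  then show ?thesis by (auto simp: nonconstant_polys_def)
qed

lemma two_neq_zero_of_CHAR:
  assumes "CHAR('a::field) \<noteq> 2"
  shows "(2::'a) \<noteq> 0"
proof
  assume "(2::'a) = 0"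
  then have "of_nat 2 = (0::'a)" by simp
  then have "CHAR('a) dvd 2" by (simp only: of_nat_eq_0_iff_char_dvd)
  then have "CHAR('a) = 1 \<or> CHAR('a) = 2" by (meson prime_nat_iff two_is_prime_nat)
  with assms show False by (simp add: CHAR_not_1)
qed

lemma two_mult_poly: "2 * (f :: 'a::field poly) = smult 2 f"
  by (metis mult_2 one_add_one smult_1_left smult_add_left)

text \<open>Taking degrees in x^2 = (y + z)(z - y) makes deg x the mean of the degrees of the two
  factors, so a lower bound for one is an upper bound for the other.\<close>

lemma degree_pythagorean:
  fixes P :: "('a::field poly)^3"
  assumes "(P$1)\<^sup>2 + (P$2)\<^sup>2 = (P$3)\<^sup>2" "P$1 \<noteq> 0"
  shows "P$3 - P$2 \<noteq> 0" "P$2 + P$3 \<noteq> 0"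
    "degree (P$2 + P$3) + degree (P$3 - P$2) = 2 * degree (P$1)"
proof -
  have eq: "(P$1)\<^sup>2 = (P$2 + P$3) * (P$3 - P$2)"
    using assms pythagorean_factor by blast
  show nz: "P$3 - P$2 \<noteq> 0" "P$2 + P$3 \<noteq> 0"
    using eq assms(2) by (metis mult_zero_right mult_zero_left power_not_zero)+
  have "degree ((P$1)\<^sup>2) = 2 * degree (P$1)"
    by (simp add: degree_power_eq assms(2))
  then show "degree (P$2 + P$3) + degree (P$3 - P$2) = 2 * degree (P$1)"
    using eq degree_mult_eq nz by metis
qed

section \<open>Action of M_f on reduced triples\<close>

lemma reduced_triple_M_mat:
  fixes P :: "('a::field poly)^3"
  assumes two: "(2::'a) \<noteq> 0" and P: "reduced_triple P" and f: "f \<in> nonconstant_polys"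
  shows "reduced_triple (M_mat f *v P)" "(M_mat f *v P) $ 1 \<noteq> 0"
proof -
  let ?R = "M_mat f *v P" and ?a = "P$2 + P$3"
  have df: "degree f > 0" using f by (simp add: nonconstant_polys_iff)
  have a: "?a \<noteq> 0" "P$1 = 0 \<or> degree (P$1) < degree ?a"
    using P by (auto simp: reduced_triple_def)
  have R1: "?R $ 1 = smult 2 (f * ?a) + (- P$1)"
    unfolding M_mat_vec_nth two_mult_poly[symmetric] by (simp add: algebra_simps)
  have dfa: "degree (smult 2 (f * ?a)) = degree f + degree ?a"
    using two a df by (subst degree_smult_eq, subst degree_mult_eq) auto
  \<comment> \<open>The term 2fa dominates x, whose degree is below that of a unless x = 0.\<close>
  have dR: "degree (?R $ 1) = degree f + degree ?a"
  proof (cases "P$1 = 0")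
    case True
    then show ?thesis using dfa by (simp add: R1)
  next
    case False
    then have "degree (- P$1) < degree (smult 2 (f * ?a))" using a(2) dfa by simp
    then show ?thesis unfolding R1 using dfa by (simp only: degree_add_eq_left)
  qed
  then show nz: "?R $ 1 \<noteq> 0" using df by auto
  have pyth: "(?R$1)\<^sup>2 + (?R$2)\<^sup>2 = (?R$3)\<^sup>2"
    using P M_mat_pythagorean unfolding reduced_triple_def by blast
  note d = degree_pythagorean[OF pyth nz]
  \<comment> \<open>With this, the degree formula gives the new y + z the degree 2 deg f + deg a,
    which exceeds deg f + deg a.\<close>
  have "?R$3 - ?R$2 = ?a" by (simp add: M_mat_vec_nth algebra_simps)
  then show "reduced_triple ?R"
    using d dR df pyth by (simp add: reduced_triple_def)
qed

lemma reduced_triple_cancel_M_mat: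
  fixes P R :: "('a::field poly)^3"
  assumes two: "(2::'a) \<noteq> 0" and P: "reduced_triple P" and R: "reduced_triple R"
    and eq: "M_mat f *v P = M_mat g *v R"
  shows "f = g" "P = R"
proof -
  let ?a = "P$2 + P$3"
  have "(M_mat f *v P)$3 - (M_mat f *v P)$2 = (M_mat g *v R)$3 - (M_mat g *v R)$2"
    using eq by simp
  then have a: "R$2 + R$3 = ?a" by (simp add: M_mat_vec_nth algebra_simps)
  have "(M_mat f *v P)$1 = (M_mat g *v R)$1" using eq by simp
  moreover have "(M_mat f *v P)$1 = smult 2 f * ?a - P$1"
    unfolding M_mat_vec_nth two_mult_poly[symmetric] by (simp add: algebra_simps)
  moreover have "(M_mat g *v R)$1 = smult 2 g * ?a - R$1"
    unfolding M_mat_vec_nth two_mult_poly[symmetric] a[symmetric] by (simp add: algebra_simps)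
  ultimately have "smult 2 f * ?a - P$1 = smult 2 g * ?a - R$1" by simp
  \<comment> \<open>Both sides divide the same polynomial by a, with quotients 2f, 2g and remainders
    -\<open>P$1\<close>, -\<open>R$1\<close>; the rest is uniqueness of division.\<close>
  then have key: "smult 2 (f - g) * ?a = P$1 - R$1"
    by (simp add: smult_diff_right algebra_simps)
  show "f = g"
  proof (rule ccontr)
    assume "f \<noteq> g"
    then have nz: "smult 2 (f - g) \<noteq> 0" using two by simp
    have a0: "?a \<noteq> 0" using P by (simp add: reduced_triple_def)
    \<comment> \<open>This covers constant a: both first entries are then 0, and the degree of their
      difference would not be below \<open>degree ?a\<close>.\<close>
    have ne: "P$1 - R$1 \<noteq> 0" using nz a0 key by (metis mult_eq_0_iff)
    have "degree (P$1 - R$1) \<ge> degree ?a"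
      unfolding key[symmetric] by (subst degree_mult_eq[OF nz a0]) simp
    moreover have "degree (P$1 - R$1) < degree ?a"
      using P R a ne by (auto simp: reduced_triple_def intro: degree_diff_less)
    ultimately show False by simp
  qed
  with eq show "P = R" by (metis M_inv_M_mat)
qed

section \<open>Products of matrices and the vector S_f\<close>

lemma M_prod_Nil_vec [simp]: "M_prod [] *v v = v"
  by (simp add: M_prod_def matrix_vector_mul_lid)

lemma M_prod_Cons_vec [simp]: "M_prod (f # fs) *v v = M_mat f *v (M_prod fs *v v)"
  by (simp add: M_prod_def matrix_vector_mul_assoc)

lemma M_prod_snoc_vec: "M_prod (fs @ [f]) *v v = M_prod fs *v (M_mat f *v v)"
  by (induction fs) simp_all

lemma M_mat_scale: "M_mat f *v (k *s v) = k *s (M_mat f *v v)"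
  by (simp add: vec_eq_iff matrix_vector_mult_def sum_distrib_left mult.left_commute)

lemma M_prod_scale: "M_prod fs *v (k *s v) = k *s (M_prod fs *v v)"
  by (induction fs) (simp_all add: M_mat_scale)

lemma S_vec_eq_M_mat:
  fixes f :: "'a::field poly"
  assumes two: "(2::'a) \<noteq> 0"
  shows "[:c:] *s S_vec f = M_mat (smult (1/2) f) *v base_triple c"
proof -
  \<comment> \<open>Writing f = 2g turns the claim into an identity of polynomials without
    division.\<close>
  have "k *s S_vec (2 * g) = M_mat g *v vector [0, k, k]" for g k :: "'a poly"
    by (simp add: vec_eq_iff forall_3 M_mat_vec_nth S_vec_def)
       (simp add: algebra_simps power2_eq_square)
  from this[of "[:c:]" "smult (1/2) f"] show ?thesis
    using two by (simp add: two_mult_poly base_triple_def)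
qed

text \<open>The data (c, f, fs) become a scalar and one nonempty list, on which existence and
  uniqueness can be proved by induction.\<close>

lemma representation_snoc:
  assumes "(2::'a::field) \<noteq> 0"
  shows "[:c:] *s (M_prod fs *v S_vec f)
    = M_prod (fs @ [smult (1/2) f]) *v base_triple (c :: 'a)"
  by (simp only: M_prod_snoc_vec S_vec_eq_M_mat[OF assms, symmetric] M_prod_scale)

section \<open>Uniqueness of the list of matrices\<close>

lemma reduced_triple_base:
  assumes "(2::'a::field) \<noteq> 0" "c \<noteq> 0"
  shows "reduced_triple (base_triple (c::'a))"
proof -
  have "c + c \<noteq> 0" using assms by (metis mult_2 mult_eq_0_iff)
  then show ?thesis by (simp add: reduced_triple_def)
qed

lemma reduced_triple_M_prod:
  assumes "(2::'a::field) \<noteq> 0" "c \<noteq> 0" "set fs \<subseteq> nonconstant_polys"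
  shows "reduced_triple (M_prod fs *v base_triple (c::'a))"
  using assms(3)
proof (induction fs)
  case Nil
  show ?case unfolding M_prod_Nil_vec by (rule reduced_triple_base[OF assms(1,2)])
next
  case (Cons f fs)
  then show ?case
    unfolding M_prod_Cons_vec by (intro reduced_triple_M_mat(1)[OF assms(1)]) simp_all
qed

text \<open>The first entry vanishes for the empty list and for no other, so an empty list can only
  match an empty one; otherwise the leading matrices cancel.\<close>

lemma M_prod_base_inject:
  fixes c d :: "'a::field"
  assumes two: "(2::'a) \<noteq> 0" and c: "c \<noteq> 0" and d: "d \<noteq> 0"
    and "set fs \<subseteq> nonconstant_polys" "set gs \<subseteq> nonconstant_polys"
    and "M_prod fs *v base_triple c = M_prod gs *v base_triple d"
  shows "c = d \<and> fs = gs"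
  using assms(4-6)
proof (induction fs arbitrary: gs)
  case Nil
  show ?case
  proof (cases gs)
    case gs: Nil
    have "base_triple c = base_triple d" using Nil.prems(3) unfolding gs M_prod_Nil_vec .
    then have "base_triple c $ 2 = base_triple d $ 2" by (rule arg_cong)
    then show ?thesis using gs by simp
  next
    case (Cons g gs')
    with Nil.prems(2) have g: "g \<in> nonconstant_polys" "set gs' \<subseteq> nonconstant_polys"
      by simp_all
    have "(M_prod gs *v base_triple d) $ 1 \<noteq> 0"
      unfolding Cons M_prod_Cons_vec
      by (rule reduced_triple_M_mat(2)[OF two reduced_triple_M_prod[OF two d g(2)] g(1)])
    then show ?thesis unfolding Nil.prems(3)[symmetric] by simp
  qed
next
  case (Cons f fs')
  have r: "reduced_triple (M_prod fs' *v base_triple c)"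
    using Cons.prems two c by (simp add: reduced_triple_M_prod)
  show ?case
  proof (cases gs)
    case Nil
    have "(M_prod (f # fs') *v base_triple c) $ 1 \<noteq> 0"
      using Cons.prems(1) reduced_triple_M_mat(2)[OF two r] by simp
    then show ?thesis unfolding Cons.prems(3) Nil by simp
  next
    case gs: (Cons g gs')
    have r': "reduced_triple (M_prod gs' *v base_triple d)"
      using Cons.prems two d gs by (simp add: reduced_triple_M_prod)
    have "M_mat f *v (M_prod fs' *v base_triple c) = M_mat g *v (M_prod gs' *v base_triple d)"
      using Cons.prems(3) gs by simp
    note canc = reduced_triple_cancel_M_mat[OF two r r' this]
    with Cons.IH[of gs'] Cons.prems gs show ?thesis by simp
  qed
qed

section \<open>Existence by descent\<close>

lemma reduced_triple_descent:
  fixes P :: "('a::field poly)^3"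
  assumes two: "(2::'a) \<noteq> 0" and P: "reduced_triple P" and x: "P$1 \<noteq> 0"
  obtains f where "f \<in> nonconstant_polys" "reduced_triple (M_inv f P)"
    "degree (M_inv f P $ 2 + M_inv f P $ 3) < degree (P$2 + P$3)"
proof -
  let ?b = "P$3 - P$2"
  \<comment> \<open>The first entry of \<open>M_inv f P\<close> is -x + 2fb. It becomes minus the
    remainder of x modulo b exactly when 2f is the quotient.\<close>
  define q where "q = P$1 div ?b"
  define f where "f = smult (1/2) q"
  have q: "2 * f = q" using two by (simp add: two_mult_poly f_def)
  have pyth: "(P$1)\<^sup>2 + (P$2)\<^sup>2 = (P$3)\<^sup>2" using P by (simp add: reduced_triple_def)
  note d = degree_pythagorean[OF pyth x]
  have lt: "degree (P$1) < degree (P$2 + P$3)" using P x by (simp add: reduced_triple_def)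
  with d have bx: "degree ?b < degree (P$1)" by linarith
  have dm: "P$1 mod ?b = 0 \<or> degree (P$1 mod ?b) < degree ?b"
    using degree_mod_less d(1) by blast
  have x_eq: "P$1 = q * ?b + P$1 mod ?b" unfolding q_def by (rule div_mult_mod_eq[symmetric])
  have "degree q > 0"
  proof (rule ccontr)
    assume "\<not> degree q > 0"
    \<comment> \<open>A constant quotient would leave x with degree at most deg b, against
      \<open>bx\<close>.\<close>
    then have "degree (q * ?b) \<le> degree ?b" using degree_mult_le[of q ?b] by linarith
    then have "degree (q * ?b + P$1 mod ?b) \<le> degree ?b"
      using dm by (intro degree_add_le) auto
    with x_eq bx show False by simp
  qed
  then have f: "f \<in> nonconstant_polys" using two by (simp add: nonconstant_polys_iff f_def)
  have "M_inv f P $ 1 = - P$1 + q * ?b" by (simp add: M_inv_nth q)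
  with x_eq have 1: "M_inv f P $ 1 = - (P$1 mod ?b)" by (simp add: algebra_simps)
  \<comment> \<open>The divisor b takes the place of y + z, so being reduced is just the degree
    bound on the remainder.\<close>
  have 2: "M_inv f P $ 2 + M_inv f P $ 3 = ?b" by (simp add: M_inv_nth)
  have "reduced_triple (M_inv f P)"
    unfolding reduced_triple_def 2 1 using dm d(1) M_inv_pythagorean[OF pyth, of f] 1 2 by simp
  with f show thesis using that 2 bx lt by simp
qed

lemma reduced_primitive_representation:
  fixes P :: "('a::field poly)^3"
  assumes two: "(2::'a) \<noteq> 0" and "reduced_triple P" "primitive_triple P"
  shows "\<exists>c fs. c \<noteq> 0 \<and> set fs \<subseteq> nonconstant_polys \<and> P = M_prod fs *v base_triple c"
  using assms(2,3)
proof (induction "degree (P$2 + P$3)" arbitrary: P rule: less_induct)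
  case less
  show ?case
  proof (cases "P$1 = 0")
    case True
    have "(P$1)\<^sup>2 + (P$2)\<^sup>2 = (P$3)\<^sup>2"
      using less.prems(1) unfolding reduced_triple_def by blast
    then have "(P$1)\<^sup>2 = (P$2 + P$3) * (P$3 - P$2)" by (simp only: pythagorean_factor)
    \<comment> \<open>As y + z is nonzero, x = 0 forces z = y. Then y divides all three entries, and
      primitivity makes it a constant.\<close>
    with True less.prems(1) have eq: "P$3 = P$2" by (simp add: reduced_triple_def)
    then have unit: "is_unit (P$2)"
      using less.prems(2) True by (simp add: primitive_triple_def)
    then obtain c where c: "P$2 = [:c:]" by (auto simp: is_unit_poly_iff)
    with unit have "c \<noteq> 0" by auto
    with c eq True have "P = M_prod [] *v base_triple c"
      by (simp add: vec_eq_iff forall_3)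
    with \<open>c \<noteq> 0\<close> show ?thesis by (intro exI[of _ c] exI[of _ "[]"]) simp
  next
    case False
    with two less.prems(1) obtain f where f: "f \<in> nonconstant_polys" "reduced_triple (M_inv f P)"
      "degree (M_inv f P $ 2 + M_inv f P $ 3) < degree (P$2 + P$3)"
      by (rule reduced_triple_descent)
    then obtain c fs where c: "c \<noteq> 0" "set fs \<subseteq> nonconstant_polys"
      "M_inv f P = M_prod fs *v base_triple c"
      using less.hyps[OF f(3,2) primitive_triple_M_inv[OF less.prems(2)]] by blast
    then have "P = M_prod (f # fs) *v base_triple c"
      by (metis M_mat_M_inv M_prod_Cons_vec)
    moreover have "set (f # fs) \<subseteq> nonconstant_polys" using c f by simp
    ultimately show ?thesis using c(1) by blast
  qed
qed

section \<open>Standard triples and the final bijection\<close>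

lemma standard_triple_reduced:
  fixes Q :: "('a::field poly)^3"
  assumes two: "(2::'a) \<noteq> 0" and Q: "standard_triple Q" and x: "Q$1 \<noteq> 0"
  shows "reduced_triple Q"
proof -
  let ?y = "Q$2" and ?z = "Q$3"
  have y: "?y \<noteq> 0" and lt: "degree (Q$1) < degree ?y"
    and deg: "degree ?y = degree ?z" and lc: "lead_coeff ?y = lead_coeff ?z"
    using Q x by (auto simp: standard_triple_def pdeg_def split: if_splits)
  \<comment> \<open>Equal leading coefficients add up to twice their value, so the top terms of y
    and z do not cancel in y + z.\<close>
  have "coeff (?y + ?z) (degree ?y) = 2 * lead_coeff ?y"
    using deg lc by simp
  also have "\<dots> \<noteq> 0" using two y by simp
  finally have nz: "coeff (?y + ?z) (degree ?y) \<noteq> 0" .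
  then have "degree ?y \<le> degree (?y + ?z)" by (rule le_degree)
  moreover have "?y + ?z \<noteq> 0" using nz by (metis coeff_0)
  ultimately show ?thesis
    using Q lt by (simp add: reduced_triple_def standard_triple_def primitive_triple_def
        pythagorean_triple_def)
qed

theorem theorem1p2:
  fixes Q :: "('a::field poly)^3"
  assumes "CHAR('a) \<noteq> 2"
    and "standard_triple Q"
    and "Q$1 \<noteq> 0"
  shows "\<exists>!(c :: 'a, f :: 'a poly, fs :: 'a poly list).
           c \<noteq> 0 \<and> f \<in> nonconstant_polys \<and> set fs \<subseteq> nonconstant_polys \<and>
           Q = [:c:] *s (M_prod fs *v S_vec f)"
proof -
  have two: "(2::'a) \<noteq> 0" by (rule two_neq_zero_of_CHAR[OF assms(1)])
  have nc: "smult (1/2) g \<in> nonconstant_polys \<longleftrightarrow> g \<in> nonconstant_polys" for g :: "'a poly"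
    using two by (simp add: nonconstant_polys_iff)
  have prim: "primitive_triple Q" using assms(2) by (simp add: standard_triple_def)
  obtain c gs where c: "c \<noteq> 0" "set gs \<subseteq> nonconstant_polys" "Q = M_prod gs *v base_triple c"
    using reduced_primitive_representation[OF two standard_triple_reduced[OF two assms(2,3)] prim]
    by blast
  \<comment> \<open>An empty list would give a base triple, whose first entry is 0. The last element
    h of the list plays the part of f/2, so the witness for f is 2h.\<close>
  have "gs \<noteq> []" using c(3) assms(3) by auto
  then obtain fs h where gs: "gs = fs @ [h]" by (cases gs rule: rev_cases) auto
  have h: "smult (1/2) (smult 2 h) = h" using two by simp
  show ?thesis
  proof (rule ex1I[of _ "(c, smult 2 h, fs)"], goal_cases)
    case 1
    have "Q = [:c:] *s (M_prod fs *v S_vec (smult 2 h))"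
      unfolding representation_snoc[OF two] h using c(3) gs by simp
    moreover have "smult 2 h \<in> nonconstant_polys"
      using nc[of "smult 2 h"] c(2) gs unfolding h by simp
    ultimately show ?case using c gs by simp
  next
    case (2 t)
    obtain d f fs' where t: "t = (d, f, fs')" by (cases t)
    with 2 have d: "d \<noteq> 0" "f \<in> nonconstant_polys" "set fs' \<subseteq> nonconstant_polys"
      "Q = M_prod (fs' @ [smult (1/2) f]) *v base_triple d"
      by (simp_all add: representation_snoc[OF two])
    \<comment> \<open>Any other representation also yields a list ending in half of its f; comparing
      last elements determines f because 2 is invertible.\<close>
    then have "d = c \<and> fs' @ [smult (1/2) f] = fs @ [h]"
      using c gs nc two by (intro M_prod_base_inject) auto
    then show ?case using t two by auto
  qed
qed

end
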